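(* Let $\mathcal{H}$ be a real Hilbert space, let $T\colon\mathcal{H}\to\mathcal{H}$ be nonexpansive with infimal displacement vector $v$, and let $\{x^k\}_{k\in\mathbb{N}}$ be the iterates of the Halpern iteration with $\lambda_k=\frac{1}{k+1}$, i.e. \[ x^{k+1}=\frac{1}{k+2}x^0+\frac{k+1}{k+2}Tx^k,\qquad k=0,1,\dots, \] starting from $x^0\in\mathcal{H}$. For any $\varepsilon>0$ there exists $x_\varepsilon\in\mathcal{H}$ such that $\|x_\varepsilon-Tx_\varepsilon-v\|<\varepsilon$ and, for $k=1,2,\dots$, \[ \left\|\frac{2(x^k-x^0)}{k}+v\right\|^2\le\left(\frac4k\|x^0-x_\varepsilon\|+\varepsilon\right)^2, \qquad \left(\|x^k-Tx^k\|-\|v\|\right)^2\le\left(\frac4k\|x^0-x_\varepsilon\|+\varepsilon\right)^2, \] \[ \|x^k-Tx^k-v\|^2\le\left(\frac{\sqrt{\sum_{n=1}^k\frac1n+4}+1}{k+1}\right)^2\|x^0-x_\varepsilon\|^2+\varepsilon. \] If furthermore $v\in\mathcal{R}(I-T)$, then there exists $x_\star\in\mathcal{H}$ such that $x_\star-Tx_\star=v$ and, for $k=1,2,\dots$, \[ \left\|\frac{2(x^k-x^0)}{k}+v\right\|^2\le\frac{16}{k^2}\|x^0-x_\star\|^2, \qquad \left(\|x^k-Tx^k\|-\|v\|\right)^2\le\frac{16}{k^2}\|x^0-x_\star\|^2, \] \[ \|x^k-Tx^k-v\|^2\le\left(\frac{\sqrt{\sum_{n=1}^k\frac1n+4}+1}{k+1}\right)^2\|x^0-x_\star\|^2.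 \]
   Context: $T\colon\mathcal{H}\to\mathcal{H}$ is nonexpansive if $\|Tx-Ty\|\le\|x-y\|$ for all $x,y\in\mathcal{H}$. $I$ is the identity operator and $\mathcal{R}(I-T)=\{x-Tx: x\in\mathcal{H}\}$. For nonexpansive $T$ the closure $\overline{\mathcal{R}(I-T)}$ is nonempty, closed and convex, and the infimal displacement vector of $T$ is its unique minimum-norm element $v=\Pi_{\overline{\mathcal{R}(I-T)}}(0)$. *)

theory Defs
  imports "HOL-Analysis.Analysis"
begin

definition nonexpansive :: "('a::real_normed_vector \<Rightarrow> 'a) \<Rightarrow> bool" where
  "nonexpansive T \<longleftrightarrow> (\<forall>x y. norm (T x - T y) \<le> norm (x - y))"

lemma nonexpansive_iff_lipschitz: "nonexpansive T \<longleftrightarrow> 1-lipschitz_on UNIV T"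
  by (simp add: nonexpansive_def lipschitz_on_def dist_norm)

definition displacement_range :: "('a::real_normed_vector \<Rightarrow> 'a) \<Rightarrow> 'a set" where
  "displacement_range T = range (\<lambda>x. x - T x)"

text \<open>Metric projection. The library's \<open>closest_point\<close> requires the class \<open>heine_borel\<close>,
  i.e. finite dimension, so it is not available in a general Hilbert space. The description is
  proper whenever \<open>S\<close> is a nonempty closed convex subset of a Hilbert space.\<close>

definition metric_projection :: "'a::real_normed_vector set \<Rightarrow> 'a \<Rightarrow> 'a" where
  "metric_projection S a = (THE p. p \<in> S \<and> (\<forall>y\<in>S. norm (a - p) \<le> norm (a - y)))"

text \<open>For nonexpansive \<open>T\<close> on a Hilbert space, \<open>closure (displacement_range T)\<close> is convex, so this
  is its unique element of minimum norm.\<close>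

definition infimal_displacement :: "('a::real_normed_vector \<Rightarrow> 'a) \<Rightarrow> 'a" where
  "infimal_displacement T = metric_projection (closure (displacement_range T)) 0"

end

theory Submission
  imports Defs
begin

text \<open>Write \<open>g\<^sub>k = x\<^sub>k - T x\<^sub>k\<close> and \<open>h\<^sub>k = g\<^sub>k - v\<close>. Two properties of \<open>v\<close> drive everything: it is a
  limit of displacements, and \<open>\<parallel>v\<parallel>\<^sup>2 \<le> \<langle>v, y - T y\<rangle>\<close> for every \<open>y\<close>
  (lemma \<open>infimal_displacement_variational\<close>). The second makes an almost minimal displacement
  almost equal to \<open>v\<close>.

  For the normalized iterate, start a second Halpern sequence at a reference point \<open>z\<close>. The two
  sequences never get farther apart than \<open>\<parallel>x\<^sub>0 - z\<parallel>\<close>. If \<open>z - T z\<close> is close to \<open>v\<close>, the second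
  sequence moves almost exactly along \<open>z - (k/2) v\<close>: its speed is bounded above by the displacement
  of \<open>z\<close> and, in direction \<open>-v\<close>, bounded below by the variational inequality
  (lemma \<open>halpern_drift\<close>). The bound for \<open>\<parallel>g\<^sub>k\<parallel>\<close> follows from it, since the usual potential of the Halpern
  iteration gives \<open>\<parallel>g\<^sub>k\<parallel> \<le> (2/k) \<parallel>x\<^sub>k - x\<^sub>0\<parallel>\<close> even when \<open>T\<close> has no fixed point
  (lemma \<open>halpern_residual_le\<close>).

  The bound for \<open>\<parallel>h\<^sub>k\<parallel>\<close> exploits that the reference point is only asserted to exist. If \<open>v \<noteq> 0\<close>,
  replacing \<open>z\<close> by a late point of its orbit under \<open>T\<close> does not increase the displacement but moves
  it arbitrarily far away (lemma \<open>exists_far_point\<close>). Hence the factor \<open>\<parallel>x\<^sub>0 - z\<parallel>\<close> absorbs every constant that is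
  independent of \<open>k\<close>, and only the order of decay matters. When
  \<open>v\<close> is attained this order, \<open>\<parallel>h\<^sub>k\<parallel>\<^sup>2 = O((1 + \<Sum>n\<le>k. 1/n) / k\<^sup>2)\<close>, is proved in
  \<open>halpern_residual_log_rate\<close>; with the tolerance \<open>\<epsilon>\<close> the convergence \<open>h\<^sub>k \<rightarrow> 0\<close> is enough,
  because only finitely many \<open>k\<close> remain. If \<open>v = 0\<close> no such enlargement is available, but then the
  potential argument directly gives a rate \<open>O(1/k\<^sup>2)\<close> for \<open>\<parallel>g\<^sub>k\<parallel>\<^sup>2\<close> with a constant below the required one
  (lemma \<open>halpern_residual_rate_zero\<close>).\<close>

section \<open>The infimal displacement vector\<close>

text \<open>Cocoercivity of \<open>I - T\<close>, obtained by expanding the square of \<open>\<parallel>T y - T z\<parallel>\<close>. It is the only form in which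
  nonexpansiveness enters the potential arguments below.\<close>

lemma nonexpansive_displacement_monotone:
  fixes T :: "'a::real_inner \<Rightarrow> 'a"
  assumes "nonexpansive T"
  shows "(norm ((y - T y) - (z - T z)))\<^sup>2 \<le> 2 * ((y - z) \<bullet> ((y - T y) - (z - T z)))"
proof -
  have "norm (T y - T z) \<le> norm (y - z)"
    using assms by (simp add: nonexpansive_def)
  then have "(norm (T y - T z))\<^sup>2 \<le> (norm (y - z))\<^sup>2"
    by (simp add: power_mono)
  then show ?thesis
    unfolding power2_norm_eq_inner
    by (simp add: inner_diff_left inner_diff_right inner_commute algebra_simps)
qed

text \<open>The equation says that \<open>y\<close> is fixed by the contraction \<open>T / (1 + \<mu>)\<close>.\<close>

lemma regularized_zero_exists:
  fixes T :: "'a::{real_inner, complete_space} \<Rightarrow> 'a"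
  assumes T: "nonexpansive T" and "\<mu> > 0"
  shows "\<exists>y. y - T y = - (\<mu> *\<^sub>R y)"
proof -
  define t where "t = 1 / (1 + \<mu>)"
  have t: "0 \<le> t" "t < 1" and t_mu: "t * (1 + \<mu>) = 1"
    using \<open>\<mu> > 0\<close> by (auto simp: t_def field_simps)
  have lip: "dist (t *\<^sub>R T y) (t *\<^sub>R T z) \<le> t * dist y z" for y z
    using T t(1) unfolding nonexpansive_def dist_norm
    by (simp add: mult_left_mono flip: scaleR_diff_right)
  have "\<exists>!y. t *\<^sub>R T y = y"
    by (rule banach_fix_type[OF t]) (use lip in blast)
  then obtain y where y: "t *\<^sub>R T y = y" by blast
  have "(1 + \<mu>) *\<^sub>R y = ((1 + \<mu>) * t) *\<^sub>R T y"
    by (metis y scaleR_scaleR)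
  also have "\<dots> = T y"
    using t_mu by (simp add: mult.commute)
  finally have "(1 + \<mu>) *\<^sub>R y = T y" .
  then have "y - T y = - (\<mu> *\<^sub>R y)"
    by (metis add_diff_cancel_left' minus_diff_eq scaleR_left_distrib scaleR_one)
  then show ?thesis by blast
qed

text \<open>The inequality to be applied to displacements \<open>p, q\<close> at zeros of the regularized operators with parameters \<open>1/b\<close> and
  \<open>1/a\<close>. It shows at once that their norms decrease as the regularization vanishes and that the
  decrease controls the distance, which is the Cauchy property.\<close>

lemma regularized_displacements_dist_le:
  fixes p q :: "'a::real_inner"
  assumes "0 < b" "b \<le> a" and "0 \<le> (p - q) \<bullet> (a *\<^sub>R q - b *\<^sub>R p)"
  shows "(norm (p - q))\<^sup>2 \<le> (norm p)\<^sup>2 - (norm q)\<^sup>2"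
proof -
  have h: "b * (p \<bullet> p) + a * (q \<bullet> q) \<le> (a + b) * (p \<bullet> q)"
    using assms(3) by (simp add: inner_diff_left inner_diff_right inner_commute algebra_simps)
  have n0: "0 \<le> (p - q) \<bullet> (p - q)" by simp
  have n: "(p - q) \<bullet> (p - q) = p \<bullet> p + q \<bullet> q - 2 * (p \<bullet> q)"
    by (simp add: inner_diff_left inner_diff_right inner_commute)
  have e: "(a + b) * ((p - q) \<bullet> (p - q)) \<le> (a - b) * (p \<bullet> p - q \<bullet> q)"
    using h unfolding n by (simp add: algebra_simps)
  have "(p - q) \<bullet> (p - q) \<le> p \<bullet> p - q \<bullet> q"
  proof (cases "a = b")
    case True
    then have "(p - q) \<bullet> (p - q) \<le> 0"
      using e assms(1) by (simp add: mult_le_0_iff)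
    then have "p = q" using n0 by simp
    then show ?thesis by simp
  next
    case False
    then have ab: "0 < a - b" using assms(2) by simp
    have "(a - b) * ((p - q) \<bullet> (p - q)) \<le> (a + b) * ((p - q) \<bullet> (p - q))"
      using n0 assms(1) by (intro mult_right_mono) auto
    then have "(a - b) * ((p - q) \<bullet> (p - q)) \<le> (a - b) * (p \<bullet> p - q \<bullet> q)"
      using e by linarith
    then show ?thesis using ab by simp
  qed
  then show ?thesis by (simp add: power2_norm_eq_inner)
qed

text \<open>As the regularization \<open>\<mu> = 1/a\<^sub>n\<close> tends to zero, the displacements at the regularized zeros form a Cauchy sequence; passing to
  the limit in the monotonicity inequality against an arbitrary \<open>y\<close> gives the variational
  inequality. This avoids proving first that the closure of the range is convex.\<close>

lemma exists_variational_displacement: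
  fixes T :: "'a::{real_inner, complete_space} \<Rightarrow> 'a"
  assumes T: "nonexpansive T"
  shows "\<exists>v \<in> closure (displacement_range T). \<forall>y. (norm v)\<^sup>2 \<le> v \<bullet> (y - T y)"
proof -
  define a where "a n = real n + 1" for n
  have a: "0 < a n" for n by (simp add: a_def)
  have "\<exists>y. y - T y = - ((1 / a n) *\<^sub>R y)" for n
    using regularized_zero_exists[OF T] a by simp
  then obtain z where z: "\<And>n. z n - T (z n) = - ((1 / a n) *\<^sub>R z n)"
    by metis
  define g where "g n = z n - T (z n)" for n
  have z_g: "z n = - (a n *\<^sub>R g n)" for n
    using z[of n] a[of n] by (simp add: g_def)
  have mono: "0 \<le> (y - u) \<bullet> ((y - T y) - (u - T u))" for y u
    using nonexpansive_displacement_monotone[OF T, of y u]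
    by (smt (verit) zero_le_power2)
  have step: "(norm (g m - g n))\<^sup>2 \<le> (norm (g m))\<^sup>2 - (norm (g n))\<^sup>2" if "m \<le> n" for m n
  proof (rule regularized_displacements_dist_le)
    show "0 < a m" "a m \<le> a n" using a that by (auto simp: a_def)
    show "0 \<le> (g m - g n) \<bullet> (a n *\<^sub>R g n - a m *\<^sub>R g m)"
    proof -
      have "z m - z n = a n *\<^sub>R g n - a m *\<^sub>R g m" by (simp add: z_g)
      then show ?thesis
        using mono[of "z m" "z n"] unfolding g_def[symmetric] by (simp add: inner_commute)
    qed
  qed
  define N where "N n = (norm (g n))\<^sup>2" for n
  have "decseq N"
    unfolding decseq_def N_def using step by (smt (verit) zero_le_power2)
  moreover have "0 \<le> N n" for n by (simp add: N_def)
  ultimately obtain L where "N \<longlonglongrightarrow> L"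
    using decseq_convergent[of N 0] by metis
  then have cauchy_N: "Cauchy N" by (simp add: convergent_Cauchy convergentI)
  have "Cauchy g"
  proof (rule metric_CauchyI)
    fix e :: real assume e: "0 < e"
    then obtain M where M: "\<And>m n. m \<ge> M \<Longrightarrow> n \<ge> M \<Longrightarrow> dist (N m) (N n) < e\<^sup>2"
      using metric_CauchyD[OF cauchy_N, of "e\<^sup>2"] by auto
    have "norm (g m - g n) < e" if "m \<ge> M" "m \<le> n" for m n
    proof -
      have "(norm (g m - g n))\<^sup>2 < e\<^sup>2"
        using step[OF that(2)] M[of m n] that by (simp add: N_def dist_real_def)
      then show ?thesis using e by (simp add: power_less_imp_less_base)
    qed
    then show "\<exists>M. \<forall>m\<ge>M. \<forall>n\<ge>M. dist (g m) (g n) < e"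
      by (metis dist_commute dist_norm nle_le)
  qed
  then obtain v where v: "g \<longlonglongrightarrow> v"
    using Cauchy_convergent convergent_def by blast
  have "v \<in> closure (displacement_range T)"
    unfolding closure_sequential displacement_range_def using v
    by (intro exI[of _ g]) (auto simp: g_def)
  moreover have "(norm v)\<^sup>2 \<le> v \<bullet> (y - T y)" for y
  proof -
    have ineq: "g n \<bullet> g n \<le> (y - T y) \<bullet> g n + (1 / a n) * (((y - T y) - g n) \<bullet> y)" for n
    proof -
      have "0 \<le> (y + a n *\<^sub>R g n) \<bullet> ((y - T y) - g n)"
        using mono[of y "z n"] unfolding g_def[symmetric] by (simp add: z_g)
      then have "0 \<le> (1 / a n) * ((y + a n *\<^sub>R g n) \<bullet> ((y - T y) - g n))"
        using a[of n] by simp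
      also have "\<dots> = (1 / a n) * (((y - T y) - g n) \<bullet> y) + (y - T y) \<bullet> g n - g n \<bullet> g n"
      proof -
        define d where "d = (y - T y) - g n"
        have "(1 / a n) * ((y + a n *\<^sub>R g n) \<bullet> d) = (1 / a n) * (y \<bullet> d) + g n \<bullet> d"
          using a[of n] by (simp add: inner_add_left distrib_left)
        moreover have "g n \<bullet> d = (y - T y) \<bullet> g n - g n \<bullet> g n"
          unfolding d_def inner_diff_right[of "g n" "y - T y"] by (simp only: inner_commute)
        ultimately show ?thesis unfolding d_def by (simp only: inner_commute)
      qed
      finally show ?thesis by linarith
    qed
    have a_lim: "(\<lambda>n. 1 / a n) \<longlonglongrightarrow> 0"
      unfolding a_def using LIMSEQ_inverse_real_of_nat by (simp add: inverse_eq_divide add.commute)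
    have "(\<lambda>n. (y - T y) \<bullet> g n + (1 / a n) * (((y - T y) - g n) \<bullet> y))
        \<longlonglongrightarrow> (y - T y) \<bullet> v + 0 * (((y - T y) - v) \<bullet> y)"
      by (intro tendsto_intros v a_lim)
    moreover have "(\<lambda>n. g n \<bullet> g n) \<longlonglongrightarrow> v \<bullet> v"
      by (intro tendsto_intros v)
    ultimately have "v \<bullet> v \<le> (y - T y) \<bullet> v + 0 * (((y - T y) - v) \<bullet> y)"
      using ineq by (intro LIMSEQ_le) auto
    then show ?thesis by (simp add: power2_norm_eq_inner inner_commute)
  qed
  ultimately show ?thesis by blast
qed

text \<open>The variational inequality extends to the closure of the range and makes \<open>v\<close> its only element of
  minimum norm, so the description defining the metric projection selects \<open>v\<close>.\<close>

lemma infimal_displacement_variational: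
  fixes T :: "'a::{real_inner, complete_space} \<Rightarrow> 'a"
  assumes T: "nonexpansive T"
  shows "infimal_displacement T \<in> closure (displacement_range T)"
    and "(norm (infimal_displacement T))\<^sup>2 \<le> infimal_displacement T \<bullet> (y - T y)"
proof -
  obtain v where v: "v \<in> closure (displacement_range T)"
    and ineq: "\<And>y. (norm v)\<^sup>2 \<le> v \<bullet> (y - T y)"
    using exists_variational_displacement[OF T] by blast
  have ineq_closure: "(norm v)\<^sup>2 \<le> v \<bullet> p" if "p \<in> closure (displacement_range T)" for p
  proof -
    have "closed {p. (norm v)\<^sup>2 \<le> v \<bullet> p}"
      by (intro closed_Collect_le continuous_intros)
    moreover have "displacement_range T \<subseteq> {p. (norm v)\<^sup>2 \<le> v \<bullet> p}"
      using ineq by (auto simp: displacement_range_def)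
    ultimately have "closure (displacement_range T) \<subseteq> {p. (norm v)\<^sup>2 \<le> v \<bullet> p}"
      by (rule closure_minimal[rotated])
    then show ?thesis using that by blast
  qed
  have near: "(norm (p - v))\<^sup>2 \<le> (norm p)\<^sup>2 - (norm v)\<^sup>2"
    if "p \<in> closure (displacement_range T)" for p
    using ineq_closure[OF that] unfolding power2_norm_eq_inner
    by (simp add: inner_diff_left inner_diff_right inner_commute)
  have min: "norm v \<le> norm p" if "p \<in> closure (displacement_range T)" for p
  proof (rule power2_le_imp_le)
    show "(norm v)\<^sup>2 \<le> (norm p)\<^sup>2"
      using near[OF that] by (smt (verit) zero_le_power2)
  qed simp
  have "infimal_displacement T = v"
    unfolding infimal_displacement_def metric_projection_def
  proof (rule the_equality)
    show "v \<in> closure (displacement_range T) \<and>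
      (\<forall>p\<in>closure (displacement_range T). norm (0 - v) \<le> norm (0 - p))"
      using v min by simp
  next
    fix p
    assume p: "p \<in> closure (displacement_range T) \<and>
      (\<forall>q\<in>closure (displacement_range T). norm (0 - p) \<le> norm (0 - q))"
    then have "norm p \<le> norm v" using v by simp
    then have "(norm p)\<^sup>2 \<le> (norm v)\<^sup>2" by (simp add: power_mono)
    then have "(norm (p - v))\<^sup>2 \<le> 0" using near[of p] p by linarith
    then show "p = v" by simp
  qed
  then show "infimal_displacement T \<in> closure (displacement_range T)"
    and "(norm (infimal_displacement T))\<^sup>2 \<le> infimal_displacement T \<bullet> (y - T y)"
    using v ineq by simp_all
qed

section \<open>Displacements and orbits\<close>

locale variational_displacement =
  fixes T :: "'a::real_inner \<Rightarrow> 'a" and v :: 'a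
  assumes nonexpansive: "nonexpansive T"
    and variational: "(norm v)\<^sup>2 \<le> v \<bullet> (y - T y)"
begin

lemma nonexp: "norm (T y - T z) \<le> norm (y - z)"
  using nonexpansive by (simp add: nonexpansive_def)

text \<open>Expanding the square and inserting the variational inequality: a displacement whose norm is close to
  \<open>\<parallel>v\<parallel>\<close> is itself close to \<open>v\<close>.\<close>

lemma norm_displacement_minus_v:
  "(norm (y - T y - v))\<^sup>2 \<le> (norm (y - T y))\<^sup>2 - (norm v)\<^sup>2"
proof -
  have "(norm (y - T y - v))\<^sup>2 = (norm (y - T y))\<^sup>2 - 2 * (v \<bullet> (y - T y)) + (norm v)\<^sup>2"
    unfolding power2_norm_eq_inner
    by (simp add: inner_diff_left inner_diff_right inner_commute)
  then show ?thesis using variational[of y] by linarith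
qed

lemma norm_v_le: "norm v \<le> norm (y - T y)"
proof (rule power2_le_imp_le)
  show "(norm v)\<^sup>2 \<le> (norm (y - T y))\<^sup>2"
    using norm_displacement_minus_v[of y] by (smt (verit) zero_le_power2)
qed simp

lemma displacement_eq_v:
  assumes "norm (y - T y) \<le> norm v"
  shows "y - T y = v"
proof -
  have "(norm (y - T y))\<^sup>2 \<le> (norm v)\<^sup>2" using assms by (simp add: power_mono)
  then have "(norm (y - T y - v))\<^sup>2 \<le> 0" using norm_displacement_minus_v[of y] by linarith
  then show ?thesis by simp
qed

lemma displacement_orbit_le: "norm ((T ^^ n) y - T ((T ^^ n) y)) \<le> norm (y - T y)"
proof (induction n)
  case (Suc n)
  then show ?case using nonexp[of "(T ^^ n) y" "T ((T ^^ n) y)"] by simp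
qed simp

text \<open>Every application of \<open>T\<close> moves a point by at least \<open>\<parallel>v\<parallel>\<close> in direction \<open>-v\<close>.\<close>

lemma orbit_drift: "real n * (norm v)\<^sup>2 \<le> v \<bullet> (y - (T ^^ n) y)"
proof (induction n)
  case (Suc n)
  then show ?case
    using variational[of "(T ^^ n) y"] by (simp add: inner_diff_right algebra_simps)
qed simp

text \<open>Displacements do not grow along an orbit, while the drift makes the orbit leave every ball.\<close>

lemma exists_far_point:
  assumes "v \<noteq> 0"
  shows "\<exists>z. norm (z - T z) \<le> norm (y - T y) \<and> R \<le> norm (p - z)"
proof -
  obtain n where n: "(R + norm (p - y)) / norm v \<le> real n"
    using real_arch_simple by blast
  define z where "z = (T ^^ n) y"
  have "real n * norm v * norm v \<le> norm v * norm (y - z)"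
    using orbit_drift[of n y] norm_cauchy_schwarz[of v "y - z"]
    by (simp add: z_def power2_eq_square)
  then have "real n * norm v \<le> norm (y - z)" using assms by (simp add: mult.commute)
  moreover have "R + norm (p - y) \<le> real n * norm v"
    using n assms by (simp add: field_simps)
  moreover have "norm (y - z) \<le> norm (p - y) + norm (p - z)"
    using norm_triangle_ineq4[of "p - z" "p - y"] by simp
  ultimately have "R \<le> norm (p - z)" by linarith
  then show ?thesis using displacement_orbit_le[of n y] by (auto simp: z_def)
qed

end

section \<open>The Halpern iteration\<close>

primrec halpern :: "('a::real_vector \<Rightarrow> 'a) \<Rightarrow> 'a \<Rightarrow> nat \<Rightarrow> 'a" where
  "halpern T x0 0 = x0"
| "halpern T x0 (Suc k) =
     (1 / (real k + 2)) *\<^sub>R x0 + ((real k + 1) / (real k + 2)) *\<^sub>R T (halpern T x0 k)"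

lemma halpern_Suc_scaled:
  "(real k + 2) *\<^sub>R halpern T x0 (Suc k) = x0 + (real k + 1) *\<^sub>R T (halpern T x0 k)"
  by (simp add: scaleR_add_right)

text \<open>One step of the Halpern iteration: \<open>p, q\<close> are consecutive positions relative to the start and
  \<open>g, h\<close> the displacements there, so that \<open>ineq\<close> is monotonicity between consecutive iterates. It is used with
  \<open>r = 0\<close> for the iteration itself, and with a nonzero \<open>r\<close> after the drift \<open>(k/2) v\<close> has been
  removed.\<close>

lemma halpern_step_potential:
  fixes p q g h :: "'a::real_inner"
  assumes c: "c > 0" and pq: "(c + 1) *\<^sub>R q = c *\<^sub>R (p - g)"
    and ineq: "(norm (h - g))\<^sup>2 \<le> 2 * ((q - p) \<bullet> (h - g)) + r"
  shows "c * (c + 1) * (norm h)\<^sup>2 + 2 * (c + 1) * (q \<bullet> h)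
    \<le> (c - 1) * c * (norm g)\<^sup>2 + 2 * c * (p \<bullet> g) + c * (c + 1) * r"
proof -
  have qh: "(c + 1) * (q \<bullet> h) = c * (p \<bullet> h - g \<bullet> h)"
    using arg_cong[OF pq, of "\<lambda>u. u \<bullet> h"] by (simp add: inner_diff_left)
  have qg: "(c + 1) * (q \<bullet> g) = c * (p \<bullet> g - g \<bullet> g)"
    using arg_cong[OF pq, of "\<lambda>u. u \<bullet> g"] by (simp add: inner_diff_left)
  have "h \<bullet> h - 2 * (g \<bullet> h) + g \<bullet> g \<le> 2 * (q \<bullet> h - p \<bullet> h + p \<bullet> g - q \<bullet> g) + r"
    using ineq unfolding power2_norm_eq_inner
    by (simp add: inner_diff_left inner_diff_right inner_commute)
  then have "c * (c + 1) * (h \<bullet> h - 2 * (g \<bullet> h) + g \<bullet> g)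
      \<le> c * (c + 1) * (2 * (q \<bullet> h - p \<bullet> h + p \<bullet> g - q \<bullet> g) + r)"
    using c by (intro mult_left_mono) auto
  also have "\<dots> = 2 * (c * ((c + 1) * (q \<bullet> h))) - 2 * (c + 1) * (c * (p \<bullet> h))
      + 2 * (c + 1) * (c * (p \<bullet> g)) - 2 * (c * ((c + 1) * (q \<bullet> g))) + c * (c + 1) * r"
    by (simp add: algebra_simps)
  also have "c * (p \<bullet> h) = (c + 1) * (q \<bullet> h) + c * (g \<bullet> h)"
    using qh by (simp add: algebra_simps)
  also have "2 * (c * ((c + 1) * (q \<bullet> g))) = 2 * c * (c * (p \<bullet> g - g \<bullet> g))"
    using qg by simp
  finally show ?thesis
    unfolding power2_norm_eq_inner by (simp add: algebra_simps)
qed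

context variational_displacement
begin

text \<open>The potential \<open>k (k + 1) \<parallel>g\<^sub>k\<parallel>\<^sup>2 + 2 (k + 1) \<langle>x\<^sub>k - x\<^sub>0, g\<^sub>k\<rangle>\<close> vanishes at \<open>k = 0\<close> and never increases.\<close>

lemma halpern_residual_potential:
  "real k * (norm (halpern T x0 k - T (halpern T x0 k)))\<^sup>2
    + 2 * ((halpern T x0 k - x0) \<bullet> (halpern T x0 k - T (halpern T x0 k))) \<le> 0"
proof -
  define x where "x = halpern T x0"
  define g where "g k = x k - T (x k)" for k
  have V: "real k * (real k + 1) * (norm (g k))\<^sup>2 + 2 * (real k + 1) * ((x k - x0) \<bullet> g k) \<le> 0"
    for k
  proof (induction k)
    case 0
    show ?case by (simp add: x_def)
  next
    case (Suc k)
    have "(real k + 2) *\<^sub>R (x (Suc k) - x0) = (real k + 1) *\<^sub>R (x k - x0 - g k)"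
      using halpern_Suc_scaled[of k T x0] unfolding x_def[symmetric] g_def
      by (simp add: algebra_simps flip: scaleR_2)
    then have "(real k + 1 + 1) *\<^sub>R (x (Suc k) - x0) = (real k + 1) *\<^sub>R (x k - x0 - g k)"
      by (simp add: add.commute)
    moreover have "(norm (g (Suc k) - g k))\<^sup>2
        \<le> 2 * (((x (Suc k) - x0) - (x k - x0)) \<bullet> (g (Suc k) - g k)) + 0"
      using nonexpansive_displacement_monotone[OF nonexpansive, of "x (Suc k)" "x k"]
      by (simp add: g_def)
    ultimately have "(real k + 1) * (real k + 1 + 1) * (norm (g (Suc k)))\<^sup>2
        + 2 * (real k + 1 + 1) * ((x (Suc k) - x0) \<bullet> g (Suc k))
      \<le> (real k + 1 - 1) * (real k + 1) * (norm (g k))\<^sup>2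
        + 2 * (real k + 1) * ((x k - x0) \<bullet> g k) + (real k + 1) * (real k + 1 + 1) * 0"
      by (intro halpern_step_potential) auto
    then show ?case using Suc by (simp add: add.commute)
  qed
  have "(real k + 1) * (real k * (norm (g k))\<^sup>2 + 2 * ((x k - x0) \<bullet> g k)) \<le> 0"
    using V[of k] by (simp add: algebra_simps)
  then show ?thesis
    unfolding g_def x_def by (smt (verit) mult_le_0_iff of_nat_0_le_iff)
qed

lemma halpern_residual_le:
  assumes "k \<ge> 1"
  shows "norm (halpern T x0 k - T (halpern T x0 k)) \<le> 2 / real k * norm (halpern T x0 k - x0)"
proof -
  define g where "g = halpern T x0 k - T (halpern T x0 k)"
  define y where "y = halpern T x0 k - x0"
  have "real k * (norm g)\<^sup>2 \<le> - 2 * (y \<bullet> g)"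
    using halpern_residual_potential[of k x0] by (simp add: g_def y_def)
  also have "\<dots> \<le> 2 * (norm y * norm g)"
    using Cauchy_Schwarz_ineq2[of y g] by linarith
  finally have "norm g * (real k * norm g) \<le> norm g * (2 * norm y)"
    by (simp add: power2_eq_square algebra_simps)
  then have "real k * norm g \<le> 2 * norm y"
    by (cases "norm g = 0") auto
  then show ?thesis
    using assms unfolding g_def y_def by (simp add: field_simps)
qed

lemma halpern_contraction: "norm (halpern T x0 k - halpern T y k) \<le> norm (x0 - y)"
proof (induction k)
  case (Suc k)
  have e: "(real k + 2) *\<^sub>R (halpern T x0 (Suc k) - halpern T y (Suc k))
      = (x0 - y) + (real k + 1) *\<^sub>R (T (halpern T x0 k) - T (halpern T y k))"
    unfolding scaleR_diff_right halpern_Suc_scaled by simp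
  have "(real k + 2) * norm (halpern T x0 (Suc k) - halpern T y (Suc k))
      = norm ((x0 - y) + (real k + 1) *\<^sub>R (T (halpern T x0 k) - T (halpern T y k)))"
    using arg_cong[OF e, of norm] by (simp del: halpern.simps)
  also have "\<dots> \<le> norm (x0 - y) + (real k + 1) * norm (T (halpern T x0 k) - T (halpern T y k))"
    by (rule order_trans[OF norm_triangle_ineq]) simp
  also have "\<dots> \<le> norm (x0 - y) + (real k + 1) * norm (x0 - y)"
    using order_trans[OF nonexp Suc] by (intro add_left_mono mult_left_mono) auto
  also have "\<dots> = (real k + 2) * norm (x0 - y)"
    by (simp add: algebra_simps)
  finally show ?case by (simp del: halpern.simps)
qed simp

lemma halpern_self_growth:
  "norm (halpern T y k - y) \<le> real k / 2 * norm (y - T y)"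
proof (induction k)
  case (Suc k)
  have e: "(real k + 2) *\<^sub>R (halpern T y (Suc k) - y)
      = (real k + 1) *\<^sub>R ((T (halpern T y k) - T y) - (y - T y))"
    unfolding scaleR_diff_right halpern_Suc_scaled by (simp add: algebra_simps flip: scaleR_2)
  have "(real k + 2) * norm (halpern T y (Suc k) - y)
      = (real k + 1) * norm ((T (halpern T y k) - T y) - (y - T y))"
    using arg_cong[OF e, of norm] by (simp del: halpern.simps)
  also have "\<dots> \<le> (real k + 1) * (norm (halpern T y k - y) + norm (y - T y))"
    using nonexp[of "halpern T y k" y]
    by (intro mult_left_mono order_trans[OF norm_triangle_ineq4]) auto
  also have "\<dots> \<le> (real k + 1) * (real k / 2 * norm (y - T y) + norm (y - T y))"
    using Suc by (intro mult_left_mono) auto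
  also have "\<dots> = (real k + 2) * (real (Suc k) / 2 * norm (y - T y))"
    by (simp add: field_simps)
  finally show ?case by (simp del: halpern.simps of_nat_Suc)
qed simp

lemma halpern_self_drift:
  "real k / 2 * (norm v)\<^sup>2 \<le> v \<bullet> (y - halpern T y k)"
proof (induction k)
  case (Suc k)
  have e: "(real k + 2) *\<^sub>R (y - halpern T y (Suc k))
      = (real k + 1) *\<^sub>R ((y - halpern T y k) + (halpern T y k - T (halpern T y k)))"
    unfolding scaleR_diff_right halpern_Suc_scaled by (simp add: algebra_simps flip: scaleR_2)
  have "(real k + 2) * (real (Suc k) / 2 * (norm v)\<^sup>2)
      = (real k + 1) * (real k / 2 * (norm v)\<^sup>2 + (norm v)\<^sup>2)"
    by (simp add: field_simps)
  also have "\<dots> \<le> (real k + 1) * (v \<bullet> (y - halpern T y k)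
      + v \<bullet> (halpern T y k - T (halpern T y k)))"
    using Suc variational[of "halpern T y k"] by (intro mult_left_mono add_mono) auto
  also have "\<dots> = (real k + 2) * (v \<bullet> (y - halpern T y (Suc k)))"
    using arg_cong[OF e, of "\<lambda>u. v \<bullet> u"]
    by (simp add: inner_diff_right del: halpern.simps)
  finally show ?case by (simp del: halpern.simps of_nat_Suc)
qed simp

text \<open>A vector of length at most \<open>t \<parallel>y - T y\<parallel>\<close> whose component along \<open>-v\<close> is at least \<open>t \<parallel>v\<parallel>\<close> is
  close to \<open>- t v\<close> by Pythagoras; here \<open>t = k/2\<close> and the vector is the total move of the iteration
  started at \<open>y\<close>. In particular the move equals \<open>- (k/2) v\<close> when \<open>y - T y = v\<close>.\<close>

lemma halpern_self_linear_drift: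
  "norm (halpern T y k - y + (real k / 2) *\<^sub>R v)
    \<le> real k / 2 * sqrt ((norm (y - T y))\<^sup>2 - (norm v)\<^sup>2)"
proof (rule power2_le_imp_le)
  define d where "d = halpern T y k - y"
  define t where "t = real k / 2"
  have t: "0 \<le> t" by (simp add: t_def)
  have "norm d \<le> t * norm (y - T y)"
    using halpern_self_growth[of y k] by (simp add: d_def t_def)
  then have growth: "(norm d)\<^sup>2 \<le> t\<^sup>2 * (norm (y - T y))\<^sup>2"
    by (metis norm_ge_zero power_mono power_mult_distrib)
  have "t * (norm v)\<^sup>2 \<le> - (v \<bullet> d)"
    using halpern_self_drift[of k y] by (simp add: d_def t_def inner_diff_right)
  then have drift: "t * (t * (norm v)\<^sup>2) \<le> t * - (v \<bullet> d)"
    using t by (rule mult_left_mono)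
  have "(norm (d + t *\<^sub>R v))\<^sup>2 = (norm d)\<^sup>2 + 2 * t * (v \<bullet> d) + t\<^sup>2 * (norm v)\<^sup>2"
    unfolding power2_norm_eq_inner
    by (simp add: inner_add_left inner_add_right inner_commute power2_eq_square algebra_simps)
  also have "\<dots> \<le> t\<^sup>2 * ((norm (y - T y))\<^sup>2 - (norm v)\<^sup>2)"
    using growth drift by (simp add: power2_eq_square algebra_simps)
  also have "\<dots> = (t * sqrt ((norm (y - T y))\<^sup>2 - (norm v)\<^sup>2))\<^sup>2"
    using norm_v_le[of y] by (simp add: power_mult_distrib power_mono)
  finally show "(norm (d + t *\<^sub>R v))\<^sup>2 \<le> (t * sqrt ((norm (y - T y))\<^sup>2 - (norm v)\<^sup>2))\<^sup>2" .
  show "0 \<le> t * sqrt ((norm (y - T y))\<^sup>2 - (norm v)\<^sup>2)"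
    using norm_v_le[of y] t by (simp add: power_mono)
qed

lemma halpern_drift:
  "norm (halpern T x0 k - y + (real k / 2) *\<^sub>R v)
    \<le> norm (x0 - y) + real k / 2 * sqrt ((norm (y - T y))\<^sup>2 - (norm v)\<^sup>2)"
proof -
  have "norm (halpern T x0 k - y + (real k / 2) *\<^sub>R v)
      \<le> norm (halpern T x0 k - halpern T y k) + norm (halpern T y k - y + (real k / 2) *\<^sub>R v)"
    using norm_triangle_ineq[of "halpern T x0 k - halpern T y k"
        "halpern T y k - y + (real k / 2) *\<^sub>R v"] by (simp add: algebra_simps)
  then show ?thesis
    using halpern_contraction[of x0 k y] halpern_self_linear_drift[of y k] by linarith
qed

lemma halpern_normalized_iterate:
  assumes "k \<ge> 1"
  shows "norm ((2 / real k) *\<^sub>R (halpern T x0 k - x0) + v)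
    \<le> 4 / real k * norm (x0 - y) + sqrt ((norm (y - T y))\<^sup>2 - (norm v)\<^sup>2)"
proof -
  define s where "s = sqrt ((norm (y - T y))\<^sup>2 - (norm v)\<^sup>2)"
  have k: "real k > 0" using assms by simp
  have "(2 / real k) *\<^sub>R (halpern T x0 k - x0) + v
      = (2 / real k) *\<^sub>R ((halpern T x0 k - y + (real k / 2) *\<^sub>R v) - (x0 - y))"
    using k by (simp add: algebra_simps)
  then have "norm ((2 / real k) *\<^sub>R (halpern T x0 k - x0) + v)
      = 2 / real k * norm ((halpern T x0 k - y + (real k / 2) *\<^sub>R v) - (x0 - y))"
    using k by simp
  also have "\<dots> \<le> 2 / real k * ((norm (x0 - y) + real k / 2 * s) + norm (x0 - y))"
    unfolding s_def using halpern_drift[of x0 k y]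
    by (intro mult_left_mono order_trans[OF norm_triangle_ineq4] add_right_mono) auto
  also have "\<dots> = 4 / real k * norm (x0 - y) + s"
    using k by (simp add: field_simps)
  finally show ?thesis unfolding s_def .
qed

lemma halpern_residual_norm_gap:
  assumes "k \<ge> 1"
  shows "\<bar>norm (halpern T x0 k - T (halpern T x0 k)) - norm v\<bar>
    \<le> 4 / real k * norm (x0 - y) + sqrt ((norm (y - T y))\<^sup>2 - (norm v)\<^sup>2)"
proof -
  have "norm (halpern T x0 k - T (halpern T x0 k)) \<le> norm ((2 / real k) *\<^sub>R (halpern T x0 k - x0))"
    using halpern_residual_le[OF assms, of x0] by simp
  also have "\<dots> \<le> norm ((2 / real k) *\<^sub>R (halpern T x0 k - x0) + v) + norm v"
    using norm_triangle_ineq4[of "(2 / real k) *\<^sub>R (halpern T x0 k - x0) + v" v] by simp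
  finally show ?thesis
    using halpern_normalized_iterate[OF assms, of x0 y] norm_v_le[of "halpern T x0 k"] by linarith
qed

section \<open>Convergence of the residual to the infimal displacement vector\<close>

text \<open>Adding the potential inequality to monotonicity between \<open>x\<^sub>k\<close> and \<open>y\<close> gives a quadratic
  inequality for \<open>(k + 1) \<parallel>g\<^sub>k\<parallel>\<close>. The terms with \<open>\<parallel>y - T y\<parallel>\<close> are separated by
  Young's inequality so that their contribution does not multiply the distance \<open>\<parallel>x\<^sub>0 - y\<parallel>\<close>, which may be
  large when \<open>T\<close> has no fixed point. The constant \<open>10\<close> has to stay below \<open>(\<surd>5 + 1)\<^sup>2\<close>, the value of the claimed
  factor at \<open>k = 1\<close>.\<close>

lemma halpern_residual_rate_zero:
  assumes v0: "v = 0"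
  shows "(norm (halpern T x0 k - T (halpern T x0 k)))\<^sup>2
    \<le> 10 / (real k + 1)\<^sup>2 * (norm (x0 - y))\<^sup>2 + 12 * (norm (y - T y))\<^sup>2"
proof -
  define x where "x = halpern T x0 k"
  define g where "g = x - T x"
  define e where "e = y - T y"
  define D where "D = norm (x0 - y)"
  define \<eta> where "\<eta> = norm e"
  define c where "c = real k + 1"
  define X where "X = c * norm g"
  have c: "c \<ge> 1" and nn: "0 \<le> D" "0 \<le> \<eta>" "0 \<le> X"
    by (auto simp: c_def D_def \<eta>_def X_def)
  have far: "norm (x - y) \<le> D + c / 2 * \<eta>"
  proof -
    have "norm (x - y) \<le> D + real k / 2 * \<eta>"
      using halpern_drift[of x0 k y] v0 by (simp add: x_def D_def \<eta>_def e_def)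
    also have "\<dots> \<le> D + c / 2 * \<eta>"
      using nn by (intro add_left_mono mult_right_mono) (auto simp: c_def)
    finally show ?thesis .
  qed
  have "(norm (g - e))\<^sup>2 \<le> 2 * ((x - y) \<bullet> (g - e))"
    using nonexpansive_displacement_monotone[OF nonexpansive, of x y] by (simp add: g_def e_def)
  then have "g \<bullet> g - 2 * (g \<bullet> e) + e \<bullet> e \<le> 2 * ((x - y) \<bullet> g) - 2 * ((x - y) \<bullet> e)"
    unfolding power2_norm_eq_inner by (simp add: inner_diff_left inner_diff_right inner_commute)
  moreover have "real k * (g \<bullet> g) + 2 * ((x - y) \<bullet> g) - 2 * ((x0 - y) \<bullet> g) \<le> 0"
    using halpern_residual_potential[of k x0] unfolding power2_norm_eq_inner
    by (simp add: x_def g_def inner_diff_left)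
  moreover have "0 \<le> e \<bullet> e" by simp
  ultimately have "c * (g \<bullet> g) \<le> 2 * ((x0 - y) \<bullet> g) + 2 * (g \<bullet> e) - 2 * ((x - y) \<bullet> e)"
    unfolding c_def distrib_right mult_1_left by linarith
  also have "\<dots> \<le> 2 * (D * norm g) + 2 * (norm g * \<eta>) + 2 * ((D + c / 2 * \<eta>) * \<eta>)"
  proof -
    have "(x0 - y) \<bullet> g \<le> D * norm g" unfolding D_def by (rule norm_cauchy_schwarz)
    moreover have "g \<bullet> e \<le> norm g * \<eta>" unfolding \<eta>_def by (rule norm_cauchy_schwarz)
    moreover have "- ((x - y) \<bullet> e) \<le> norm (x - y) * \<eta>"
      unfolding \<eta>_def using Cauchy_Schwarz_ineq2[of "x - y" e] by linarith
    moreover have "norm (x - y) * \<eta> \<le> (D + c / 2 * \<eta>) * \<eta>"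
      using far nn by (intro mult_right_mono)
    ultimately show ?thesis by linarith
  qed
  finally have "c * (c * (g \<bullet> g)) \<le> c * (2 * (D * norm g) + 2 * (norm g * \<eta>) + 2 * ((D + c / 2 * \<eta>) * \<eta>))"
    using c by (intro mult_left_mono) auto
  then have main: "X\<^sup>2 \<le> 2 * D * X + 2 * \<eta> * X + 2 * (c * \<eta>) * D + (c * \<eta>)\<^sup>2"
    unfolding X_def by (simp add: power2_eq_square power2_norm_eq_inner[unfolded power2_eq_square]
        algebra_simps)
  have "2 * \<eta> * X \<le> X\<^sup>2 / 4 + 4 * \<eta>\<^sup>2"
    using zero_le_power2[of "X / 2 - 2 * \<eta>"] by (simp add: power2_eq_square algebra_simps)
  moreover have "2 * D * X \<le> X\<^sup>2 / 4 + 4 * D\<^sup>2"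
    using zero_le_power2[of "X / 2 - 2 * D"] by (simp add: power2_eq_square algebra_simps)
  moreover have "2 * (c * \<eta>) * D \<le> (c * \<eta>)\<^sup>2 + D\<^sup>2"
    using zero_le_power2[of "c * \<eta> - D"] by (simp add: power2_eq_square algebra_simps)
  moreover have "\<eta>\<^sup>2 \<le> (c * \<eta>)\<^sup>2"
    using c nn mult_right_mono[of 1 c \<eta>] by (intro power_mono) auto
  ultimately have "X\<^sup>2 \<le> 10 * D\<^sup>2 + 12 * (c * \<eta>)\<^sup>2"
    using main by linarith
  then have "c\<^sup>2 * (norm g)\<^sup>2 \<le> c\<^sup>2 * (10 / c\<^sup>2 * D\<^sup>2 + 12 * \<eta>\<^sup>2)"
    using c by (simp add: X_def power_mult_distrib distrib_left)
  then have "(norm g)\<^sup>2 \<le> 10 / c\<^sup>2 * D\<^sup>2 + 12 * \<eta>\<^sup>2"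
    using c by simp
  then show ?thesis by (simp add: g_def x_def c_def D_def \<eta>_def e_def)
qed

text \<open>The variational inequality says that this quantity is nonnegative. It measures what the drift costs in
  the potential argument.\<close>

definition excess :: "'a \<Rightarrow> nat \<Rightarrow> real" where
  "excess x0 k = v \<bullet> (halpern T x0 k - T (halpern T x0 k) - v)"

lemma excess_nonneg: "0 \<le> excess x0 k"
  using variational[of "halpern T x0 k"]
  by (simp add: excess_def inner_diff_right power2_norm_eq_inner)

lemma halpern_drift_Suc:
  "(real k + 2) *\<^sub>R (halpern T x0 (Suc k) - x0 + (real (Suc k) / 2) *\<^sub>R v)
    = (real k + 1) *\<^sub>R ((halpern T x0 k - x0 + (real k / 2) *\<^sub>R v)
        - (halpern T x0 k - T (halpern T x0 k) - v))"
proof -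
  have "(real k + 2) *\<^sub>R (halpern T x0 (Suc k) - x0 + (real (Suc k) / 2) *\<^sub>R v)
    = x0 + (real k + 1) *\<^sub>R T (halpern T x0 k) - (real k + 2) *\<^sub>R x0
      + ((real k + 2) * (real (Suc k) / 2)) *\<^sub>R v"
    by (simp only: scaleR_diff_right scaleR_add_right halpern_Suc_scaled scaleR_scaleR)
  also have "\<dots> = (real k + 1) *\<^sub>R (T (halpern T x0 k) - x0) + ((real k + 1) * (real k / 2 + 1)) *\<^sub>R v"
    by (simp add: algebra_simps add_divide_distrib flip: scaleR_2)
  finally show ?thesis by (simp add: algebra_simps)
qed

text \<open>With the drift removed, the step inequality carries the extra term \<open>excess x0 k - excess x0 (Suc k)\<close>. Its weighted sum is
  rearranged by Abel summation.\<close>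

lemma halpern_shifted_potential:
  fixes x0 :: 'a and k :: nat
  defines "u \<equiv> halpern T x0 k - x0 + (real k / 2) *\<^sub>R v"
    and "h \<equiv> halpern T x0 k - T (halpern T x0 k) - v"
  shows "real k * (real k + 1) * (norm h)\<^sup>2 + 2 * (real k + 1) * (u \<bullet> h)
    \<le> 2 * (\<Sum>j<k. (real j + 1) * excess x0 j) - real k * (real k + 1) * excess x0 k"
  unfolding u_def h_def
proof (induction k)
  case 0
  show ?case by simp
next
  case (Suc k)
  define u where "u k = halpern T x0 k - x0 + (real k / 2) *\<^sub>R v" for k
  define h where "h k = halpern T x0 k - T (halpern T x0 k) - v" for k
  define c where "c = real k + 1"
  have a: "excess x0 k = v \<bullet> h k" for k by (simp add: excess_def h_def)
  have "(norm (h (Suc k) - h k))\<^sup>2 \<le> 2 * ((u (Suc k) - u k) \<bullet> (h (Suc k) - h k))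
      + (excess x0 k - excess x0 (Suc k))"
  proof -
    have "h (Suc k) - h k = (halpern T x0 (Suc k) - T (halpern T x0 (Suc k)))
        - (halpern T x0 k - T (halpern T x0 k))"
      by (simp add: h_def)
    then have "(norm (h (Suc k) - h k))\<^sup>2
        \<le> 2 * ((halpern T x0 (Suc k) - halpern T x0 k) \<bullet> (h (Suc k) - h k))"
      using nonexpansive_displacement_monotone[OF nonexpansive, of "halpern T x0 (Suc k)" "halpern T x0 k"]
      by (simp only:)
    moreover have "halpern T x0 (Suc k) - halpern T x0 k = u (Suc k) - u k - (1 / 2) *\<^sub>R v"
      by (simp add: u_def add_divide_distrib algebra_simps del: halpern.simps)
    ultimately show ?thesis
      by (simp add: a inner_diff_left inner_diff_right algebra_simps del: halpern.simps)
  qed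
  moreover have "(c + 1) *\<^sub>R u (Suc k) = c *\<^sub>R (u k - h k)"
    using halpern_drift_Suc[of k x0] unfolding u_def[symmetric] h_def[symmetric]
    by (simp add: c_def add.commute)
  ultimately have "c * (c + 1) * (norm (h (Suc k)))\<^sup>2 + 2 * (c + 1) * (u (Suc k) \<bullet> h (Suc k))
    \<le> (c - 1) * c * (norm (h k))\<^sup>2 + 2 * c * (u k \<bullet> h k)
      + c * (c + 1) * (excess x0 k - excess x0 (Suc k))"
    by (intro halpern_step_potential) (auto simp: c_def)
  moreover have "(c - 1) * c * (norm (h k))\<^sup>2 + 2 * c * (u k \<bullet> h k)
    \<le> 2 * (\<Sum>j<k. (real j + 1) * excess x0 j) - (c - 1) * c * excess x0 k"
    using Suc unfolding u_def[symmetric] h_def[symmetric] by (simp add: c_def)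
  moreover have "real (Suc k) = c" by (simp add: c_def)
  ultimately show ?case
    unfolding u_def[symmetric] h_def[symmetric] by (simp add: c_def algebra_simps)
qed

text \<open>Monotonicity between \<open>x\<^sub>k\<close> and \<open>y\<close>, written in terms of the drift-free difference
  \<open>x\<^sub>k - (y - (k/2) v)\<close>.\<close>

lemma displacement_vs_reference:
  assumes y: "y - T y = v"
  shows "(norm (halpern T x0 k - T (halpern T x0 k) - v))\<^sup>2 + real k * excess x0 k
    \<le> 2 * ((halpern T x0 k - y + (real k / 2) *\<^sub>R v)
        \<bullet> (halpern T x0 k - T (halpern T x0 k) - v))"
proof -
  define h where "h = halpern T x0 k - T (halpern T x0 k) - v"
  have "(norm h)\<^sup>2 \<le> 2 * ((halpern T x0 k - y) \<bullet> h)"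
    using nonexpansive_displacement_monotone[OF nonexpansive, of "halpern T x0 k" y]
    by (simp add: h_def y)
  moreover have "real k * excess x0 k = 2 * ((real k / 2) *\<^sub>R v \<bullet> h)"
    by (simp add: excess_def h_def)
  ultimately have "(norm h)\<^sup>2 + real k * excess x0 k
      \<le> 2 * ((halpern T x0 k - y + (real k / 2) *\<^sub>R v) \<bullet> h)"
    unfolding inner_add_left distrib_left by linarith
  then show ?thesis unfolding h_def .
qed

text \<open>The next drift-free difference is the convex combination of \<open>x0 - y\<close> and \<open>w k - h\<^sub>k\<close> with weights
  \<open>1/(k + 2)\<close> and \<open>(k + 1)/(k + 2)\<close>, and \<open>\<parallel>w k - h\<^sub>k\<parallel>\<^sup>2\<close> is smaller than \<open>\<parallel>w k\<parallel>\<^sup>2\<close> by at least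
  \<open>k\<close> times the excess.\<close>

lemma excess_le_energy_drop:
  fixes x0 y :: 'a and k :: nat
  assumes y: "y - T y = v"
  defines "w \<equiv> \<lambda>k. halpern T x0 k - y + (real k / 2) *\<^sub>R v"
  shows "real k * (real k + 1) * excess x0 k
    \<le> (norm (x0 - y))\<^sup>2 + (real k + 1) * (norm (w k))\<^sup>2 - (real k + 2) * (norm (w (Suc k)))\<^sup>2"
proof -
  define h where "h = halpern T x0 k - T (halpern T x0 k) - v"
  define c where "c = real k + 1"
  have c: "c > 0" by (simp add: c_def)
  have ineq: "(norm h)\<^sup>2 + real k * excess x0 k \<le> 2 * (w k \<bullet> h)"
    using displacement_vs_reference[OF y, of x0 k] by (simp only: h_def w_def)
  define d where "d = w k - h"
  have d: "(norm d)\<^sup>2 \<le> (norm (w k))\<^sup>2 - real k * excess x0 k"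
    using ineq unfolding d_def power2_norm_eq_inner
    by (simp add: inner_diff_left inner_diff_right inner_commute)
  have "(real k + 2) *\<^sub>R w (Suc k) = (x0 - y) + c *\<^sub>R d"
  proof -
    have "w j = (halpern T x0 j - x0 + (real j / 2) *\<^sub>R v) + (x0 - y)" for j
      by (simp add: w_def)
    then have "(real k + 2) *\<^sub>R w (Suc k)
        = c *\<^sub>R ((halpern T x0 k - x0 + (real k / 2) *\<^sub>R v) - h) + (real k + 2) *\<^sub>R (x0 - y)"
      by (simp only: scaleR_add_right[of "real k + 2"] halpern_drift_Suc h_def c_def)
    also have "\<dots> = c *\<^sub>R d + (x0 - y)"
    proof -
      have "real k + 2 = c + 1" by (simp add: c_def)
      then show ?thesis
        by (simp only: scaleR_left_distrib scaleR_one) (simp add: d_def w_def algebra_simps)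
    qed
    finally show ?thesis by simp
  qed
  moreover have "norm ((real k + 2) *\<^sub>R w (Suc k)) = (c + 1) * norm (w (Suc k))"
    by (simp add: c_def)
  ultimately have e: "(c + 1)\<^sup>2 * (norm (w (Suc k)))\<^sup>2 = (norm ((x0 - y) + c *\<^sub>R d))\<^sup>2"
    by (simp add: power_mult_distrib)
  have "(norm ((x0 - y) + c *\<^sub>R d))\<^sup>2
      = (c + 1) * ((norm (x0 - y))\<^sup>2 + c * (norm d)\<^sup>2) - c * (norm ((x0 - y) - d))\<^sup>2"
    unfolding power2_norm_eq_inner
    by (simp add: inner_add_left inner_add_right inner_diff_left inner_diff_right inner_commute
        algebra_simps)
  also have "\<dots> \<le> (c + 1) * ((norm (x0 - y))\<^sup>2 + c * (norm d)\<^sup>2)"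
    using c by simp
  finally have "(c + 1) * ((c + 1) * (norm (w (Suc k)))\<^sup>2)
      \<le> (c + 1) * ((norm (x0 - y))\<^sup>2 + c * (norm d)\<^sup>2)"
    using e by (simp add: power2_eq_square algebra_simps)
  then have "(c + 1) * (norm (w (Suc k)))\<^sup>2 \<le> (norm (x0 - y))\<^sup>2 + c * (norm d)\<^sup>2"
    using c by simp
  also have "\<dots> \<le> (norm (x0 - y))\<^sup>2 + c * ((norm (w k))\<^sup>2 - real k * excess x0 k)"
    using d c by (intro add_left_mono mult_left_mono) auto
  finally show "real k * (real k + 1) * excess x0 k
    \<le> (norm (x0 - y))\<^sup>2 + (real k + 1) * (norm (w k))\<^sup>2 - (real k + 2) * (norm (w (Suc k)))\<^sup>2"
    by (simp add: c_def algebra_simps)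
qed

text \<open>The energy drop carries weight \<open>k (k + 1)\<close>, the sum needed here only \<open>k + 1\<close>. Dividing by \<open>k\<close>
  spoils the telescoping by terms of size \<open>1/k\<close>, whence the harmonic sum. At \<open>k = 0\<close> the energy
  gives no information, so the initial excess remains.\<close>

lemma weighted_excess_sum:
  assumes y: "y - T y = v" and k: "k \<ge> 1"
  shows "(\<Sum>j<k. (real j + 1) * excess x0 j)
    \<le> excess x0 0 + (3 * (\<Sum>n=1..k. 1 / real n) + 2) * (norm (x0 - y))\<^sup>2"
proof -
  define W where "W k = (norm (halpern T x0 k - y + (real k / 2) *\<^sub>R v))\<^sup>2" for k
  define D where "D = (norm (x0 - y))\<^sup>2"
  have W0: "0 \<le> W k" and D0: "0 \<le> D" for k by (auto simp: W_def D_def)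
  have WD: "W k \<le> D" for k
    using halpern_drift[of x0 k y] unfolding W_def D_def by (intro power_mono) (auto simp: y)
  have "(\<Sum>j<k. (real j + 1) * excess x0 j)
    \<le> excess x0 0 + 3 * (\<Sum>n=1..k. 1 / real n) * D + (real k + 1) / real k * (D - W k)"
    using k
  proof (induction k rule: dec_induct)
    case base
    show ?case using WD[of 1] D0 by simp
  next
    case (step k)
    have k: "real k \<ge> 1" using step.hyps by simp
    have "real k * ((real k + 1) * excess x0 k) \<le> D + (real k + 1) * W k - (real k + 2) * W (Suc k)"
      using excess_le_energy_drop[OF y, of k x0] by (simp add: W_def D_def mult.assoc del: halpern.simps)
    then have "(real k + 1) * excess x0 k
        \<le> (D + (real k + 1) * W k - (real k + 2) * W (Suc k)) / real k"
      using k by (simp add: field_simps)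
    also have "\<dots> = (real k + 2) / real k * (D - W (Suc k)) - (real k + 1) / real k * (D - W k)"
      using k by (simp add: field_simps)
    finally have e: "(real k + 1) * excess x0 k
        \<le> (real k + 2) / real k * (D - W (Suc k)) - (real k + 1) / real k * (D - W k)" .
    \<comment> \<open>Changing the denominator to \<open>k + 1\<close> restores the form of the induction claim; the correction is
      the next term of three times the harmonic sum.\<close>
    have "(real k + 2) / real k * (D - W (Suc k))
        = (real k + 2) / (real k + 1) * (D - W (Suc k))
          + (real k + 2) / (real k * (real k + 1)) * (D - W (Suc k))"
      using k by (simp add: divide_simps) (simp add: algebra_simps)
    also have "\<dots> \<le> (real k + 2) / (real k + 1) * (D - W (Suc k)) + 3 / (real k + 1) * D"
    proof (intro add_left_mono mult_mono)
      have "(real k + 2) / real k \<le> 3" using k by (simp add: field_simps)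
      then have "(real k + 2) / real k / (real k + 1) \<le> 3 / (real k + 1)"
        by (intro divide_right_mono) auto
      then show "(real k + 2) / (real k * (real k + 1)) \<le> 3 / (real k + 1)" by simp
    qed (use W0[of "Suc k"] WD[of "Suc k"] in auto)
    finally show ?case
      using step.IH e by (simp add: algebra_simps)
  qed
  moreover have "(real k + 1) / real k * (D - W k) \<le> 2 * D"
    using k W0[of k] WD[of k] by (intro mult_mono) (auto simp: field_simps)
  ultimately show ?thesis unfolding D_def by (simp add: algebra_simps)
qed

text \<open>In the shifted potential \<open>u = w - (x0 - y)\<close>, where \<open>w\<close> is the drift-free difference. Bounding
  \<open>\<langle>w, h\<^sub>k\<rangle>\<close> below by \<open>displacement_vs_reference\<close> leaves a quadratic inequality for
  \<open>(k + 1) \<parallel>h\<^sub>k\<parallel>\<close> whose constant term is the weighted sum of the excesses.\<close>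

lemma halpern_residual_log_rate:
  assumes y: "y - T y = v" and k: "k \<ge> 1"
  shows "(real k + 1)\<^sup>2 * (norm (halpern T x0 k - T (halpern T x0 k) - v))\<^sup>2
    \<le> (12 * (norm (x0 - y))\<^sup>2 + excess x0 0) * ((\<Sum>n=1..k. 1 / real n) + 4)"
proof -
  define h where "h = halpern T x0 k - T (halpern T x0 k) - v"
  define u where "u = halpern T x0 k - x0 + (real k / 2) *\<^sub>R v"
  define S where "S = (\<Sum>j<k. (real j + 1) * excess x0 j)"
  define H where "H = (\<Sum>n=1..k. 1 / real n)"
  define c where "c = real k + 1"
  define D where "D = norm (x0 - y)"
  define X where "X = c * norm h"
  have c: "c > 0" by (simp add: c_def)
  have a0: "0 \<le> excess x0 0" by (rule excess_nonneg)
  have H0: "0 \<le> H" unfolding H_def by (intro sum_nonneg) auto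
  have "(c - 1) * c * (norm h)\<^sup>2 + 2 * c * (u \<bullet> h) \<le> 2 * S - (c - 1) * c * excess x0 k"
    using halpern_shifted_potential[of k x0]
    unfolding h_def[symmetric] u_def[symmetric] S_def[symmetric] by (simp add: c_def)
  moreover have "(norm h)\<^sup>2 + (c - 1) * excess x0 k \<le> 2 * (u \<bullet> h) + 2 * ((x0 - y) \<bullet> h)"
  proof -
    have e: "halpern T x0 k - y + (real k / 2) *\<^sub>R v = u + (x0 - y)" by (simp add: u_def)
    show ?thesis
      using displacement_vs_reference[OF y, of x0 k] unfolding e h_def[symmetric] inner_add_left
      by (simp add: c_def)
  qed
  then have "c * ((norm h)\<^sup>2 + (c - 1) * excess x0 k) \<le> c * (2 * (u \<bullet> h) + 2 * ((x0 - y) \<bullet> h))"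
    using c by (intro mult_left_mono) auto
  moreover have "0 \<le> (c - 1) * c * excess x0 k"
    using excess_nonneg by (auto simp: c_def)
  ultimately have "c * c * (norm h)\<^sup>2 \<le> 2 * c * ((x0 - y) \<bullet> h) + 2 * S"
    by (simp add: algebra_simps)
  moreover have "2 * c * ((x0 - y) \<bullet> h) \<le> 2 * c * (D * norm h)"
    unfolding D_def using c by (intro mult_left_mono norm_cauchy_schwarz) auto
  ultimately have "X\<^sup>2 \<le> 2 * D * X + 2 * S"
    by (simp add: X_def power2_eq_square algebra_simps)
  moreover have "2 * D * X \<le> X\<^sup>2 / 2 + 2 * D\<^sup>2"
    using zero_le_power2[of "X - 2 * D"] by (simp add: power2_eq_square algebra_simps)
  moreover have "S \<le> excess x0 0 + (3 * H + 2) * D\<^sup>2"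
    using weighted_excess_sum[OF y k, of x0] by (simp add: S_def H_def D_def)
  ultimately have "X\<^sup>2 \<le> 4 * excess x0 0 + 12 * (D\<^sup>2 * H) + 12 * D\<^sup>2"
    by (simp add: algebra_simps)
  also have "\<dots> \<le> (12 * D\<^sup>2 + excess x0 0) * (H + 4)"
    using mult_nonneg_nonneg[OF a0 H0] by (simp add: algebra_simps)
  finally show ?thesis
    by (simp add: X_def c_def h_def D_def H_def power_mult_distrib)
qed

lemma approximate_minimal_displacement:
  assumes v: "v \<in> closure (displacement_range T)" and c: "c > 0"
  shows "\<exists>y. (norm (y - T y))\<^sup>2 - (norm v)\<^sup>2 < c"
proof -
  obtain g where g: "\<And>n. g n \<in> displacement_range T" and lim: "g \<longlonglongrightarrow> v"
    using v unfolding closure_sequential by blast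
  have "(\<lambda>n. (norm (g n))\<^sup>2) \<longlonglongrightarrow> (norm v)\<^sup>2"
    by (intro tendsto_intros lim)
  then have "eventually (\<lambda>n. (norm (g n))\<^sup>2 < (norm v)\<^sup>2 + c) sequentially"
    using c by (intro order_tendstoD) auto
  then obtain n where "(norm (g n))\<^sup>2 < (norm v)\<^sup>2 + c"
    using eventually_sequentially by auto
  moreover obtain y where "g n = y - T y"
    using g[of n] by (auto simp: displacement_range_def)
  ultimately show ?thesis by (intro exI[of _ y]) simp
qed

text \<open>The norms converge to \<open>\<parallel>v\<parallel>\<close> by the gap estimate with reference points of almost minimal
  displacement, and by \<open>norm_displacement_minus_v\<close> this forces the vectors to converge.\<close>

lemma halpern_residual_tendsto:
  assumes v: "v \<in> closure (displacement_range T)"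
  shows "(\<lambda>k. halpern T x0 k - T (halpern T x0 k)) \<longlonglongrightarrow> v"
proof -
  define g where "g k = halpern T x0 k - T (halpern T x0 k)" for k
  have norm_lim: "(\<lambda>k. norm (g k)) \<longlonglongrightarrow> norm v"
  proof (rule LIMSEQ_I)
    fix e :: real assume e: "e > 0"
    then obtain y where "(norm (y - T y))\<^sup>2 - (norm v)\<^sup>2 < (e / 2)\<^sup>2"
      using approximate_minimal_displacement[OF v, of "(e / 2)\<^sup>2"] by auto
    then have s: "sqrt ((norm (y - T y))\<^sup>2 - (norm v)\<^sup>2) < e / 2"
      using e real_sqrt_less_mono by fastforce
    obtain K where K: "8 * norm (x0 - y) / e < real K"
      using reals_Archimedean2 by blast
    have "norm (norm (g k) - norm v) < e" if "k \<ge> Suc K" for k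
    proof -
      have k: "k \<ge> 1" "real k \<ge> real K" "real k > 0" using that by auto
      have "8 * norm (x0 - y) < real K * e" using K e by (simp add: field_simps)
      also have "\<dots> \<le> real k * e" using k e by (intro mult_right_mono) auto
      finally have "4 / real k * norm (x0 - y) < e / 2"
        using k by (simp add: field_simps)
      then show ?thesis
        using halpern_residual_norm_gap[OF k(1), of x0 y] s by (simp add: g_def)
    qed
    then show "\<exists>K. \<forall>k\<ge>K. norm (norm (g k) - norm v) < e" by blast
  qed
  have "(\<lambda>k. sqrt ((norm (g k))\<^sup>2 - (norm v)\<^sup>2)) \<longlonglongrightarrow> sqrt ((norm v)\<^sup>2 - (norm v)\<^sup>2)"
    by (intro tendsto_intros norm_lim)
  then have "(\<lambda>k. sqrt ((norm (g k))\<^sup>2 - (norm v)\<^sup>2)) \<longlonglongrightarrow> 0" by simp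
  moreover have "norm (g k - v) \<le> sqrt ((norm (g k))\<^sup>2 - (norm v)\<^sup>2)" for k
    using norm_displacement_minus_v[of "halpern T x0 k"] by (simp add: g_def real_le_rsqrt)
  ultimately have "(\<lambda>k. g k - v) \<longlonglongrightarrow> 0"
    by (intro Lim_null_comparison[of "\<lambda>k. g k - v"]) (auto intro: always_eventually)
  then show ?thesis unfolding g_def by (simp add: LIM_zero_iff)
qed

text \<open>Two simpler minorants of the factor in the theorem: one of the right order for large \<open>k\<close>, the other
  valid from \<open>k = 1\<close> on because the harmonic sum is then at least \<open>1\<close>.\<close>

lemma log_rate_ge:
  assumes "k \<ge> 1"
  defines "H \<equiv> \<Sum>n=1..k. 1 / real n"
  shows "(H + 4) / (real k + 1)\<^sup>2 \<le> ((sqrt (H + 4) + 1) / (real k + 1))\<^sup>2"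
    and "10 / (real k + 1)\<^sup>2 \<le> ((sqrt (H + 4) + 1) / (real k + 1))\<^sup>2"
proof -
  have "(\<Sum>n\<in>{1}. 1 / real n) \<le> H"
    unfolding H_def using assms(1) by (intro sum_mono2) auto
  then have H: "1 \<le> H" by simp
  have s: "2 \<le> sqrt (H + 4)" using H by (intro real_le_rsqrt) simp
  have e: "(sqrt (H + 4) + 1)\<^sup>2 = H + 5 + 2 * sqrt (H + 4)"
    using H by (simp add: power2_sum)
  show "(H + 4) / (real k + 1)\<^sup>2 \<le> ((sqrt (H + 4) + 1) / (real k + 1))\<^sup>2"
    unfolding power_divide e using s by (intro divide_right_mono) auto
  show "10 / (real k + 1)\<^sup>2 \<le> ((sqrt (H + 4) + 1) / (real k + 1))\<^sup>2"
    unfolding power_divide e using s H by (intro divide_right_mono) auto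
qed

text \<open>If \<open>v \<noteq> 0\<close>, the reference point is taken so far out on the orbit of \<open>y\<close> that its squared distance
  from \<open>x0\<close> exceeds the constant of the logarithmic rate; the displacement there is still \<open>v\<close>, being
  of minimum norm.\<close>

lemma exact_reference_point:
  assumes "v \<in> displacement_range T"
  shows "\<exists>z. z - T z = v \<and> (\<forall>k\<ge>1. (norm (halpern T x0 k - T (halpern T x0 k) - v))\<^sup>2
    \<le> ((sqrt ((\<Sum>n=1..k. 1 / real n) + 4) + 1) / (real k + 1))\<^sup>2 * (norm (x0 - z))\<^sup>2)"
proof -
  obtain y where y: "y - T y = v"
    using assms by (auto simp: displacement_range_def)
  show ?thesis
  proof (cases "v = 0")
    case True
    have "(norm (halpern T x0 k - T (halpern T x0 k) - v))\<^sup>2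
        \<le> ((sqrt ((\<Sum>n=1..k. 1 / real n) + 4) + 1) / (real k + 1))\<^sup>2 * (norm (x0 - y))\<^sup>2"
      if "k \<ge> 1" for k
      using halpern_residual_rate_zero[OF True, of x0 k y]
        mult_right_mono[OF log_rate_ge(2)[OF that], of "(norm (x0 - y))\<^sup>2"]
      by (simp add: True y)
    then show ?thesis using y by blast
  next
    case False
    define C where "C = 12 * (norm (x0 - y))\<^sup>2 + excess x0 0"
    have C: "0 \<le> C" using excess_nonneg by (simp add: C_def)
    obtain z where z: "norm (z - T z) \<le> norm (y - T y)" and far: "sqrt C \<le> norm (x0 - z)"
      using exists_far_point[OF False] by blast
    have far2: "C \<le> (norm (x0 - z))\<^sup>2"
      using power_mono[OF far, of 2] C by simp
    have "(norm (halpern T x0 k - T (halpern T x0 k) - v))\<^sup>2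
        \<le> ((sqrt ((\<Sum>n=1..k. 1 / real n) + 4) + 1) / (real k + 1))\<^sup>2 * (norm (x0 - z))\<^sup>2"
      if k: "k \<ge> 1" for k
    proof -
      define H where "H = (\<Sum>n=1..k. 1 / real n)"
      have H: "0 \<le> H" unfolding H_def by (intro sum_nonneg) auto
      have "(norm (halpern T x0 k - T (halpern T x0 k) - v))\<^sup>2 \<le> (H + 4) / (real k + 1)\<^sup>2 * C"
        using halpern_residual_log_rate[OF y k, of x0]
        by (simp add: C_def H_def field_simps)
      also have "\<dots> \<le> ((sqrt (H + 4) + 1) / (real k + 1))\<^sup>2 * (norm (x0 - z))\<^sup>2"
        using log_rate_ge(1)[OF k] far2 C H unfolding H_def by (intro mult_mono) auto
      finally show ?thesis unfolding H_def .
    qed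
    then show ?thesis
      using displacement_eq_v[of z] z y by (intro exI[of _ z]) auto
  qed
qed

text \<open>If \<open>v \<noteq> 0\<close>, the tolerance alone covers all \<open>k\<close> from some \<open>K\<close> on, and the remaining finitely many
  inequalities hold once the reference point is far enough away.\<close>

lemma approximate_reference_point:
  assumes v: "v \<in> closure (displacement_range T)" and e: "e > 0"
  shows "\<exists>z. (norm (z - T z))\<^sup>2 - (norm v)\<^sup>2 < e \<and>
    (\<forall>k\<ge>1. (norm (halpern T x0 k - T (halpern T x0 k) - v))\<^sup>2
    \<le> ((sqrt ((\<Sum>n=1..k. 1 / real n) + 4) + 1) / (real k + 1))\<^sup>2 * (norm (x0 - z))\<^sup>2 + e)"
proof -
  obtain y where y: "(norm (y - T y))\<^sup>2 - (norm v)\<^sup>2 < e / 12"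
    using approximate_minimal_displacement[OF v, of "e / 12"] e by auto
  show ?thesis
  proof (cases "v = 0")
    case True
    have "(norm (halpern T x0 k - T (halpern T x0 k) - v))\<^sup>2
        \<le> ((sqrt ((\<Sum>n=1..k. 1 / real n) + 4) + 1) / (real k + 1))\<^sup>2 * (norm (x0 - y))\<^sup>2 + e"
      if "k \<ge> 1" for k
      using halpern_residual_rate_zero[OF True, of x0 k y] y
        mult_right_mono[OF log_rate_ge(2)[OF that], of "(norm (x0 - y))\<^sup>2"]
      by (simp add: True)
    then show ?thesis using y e by (intro exI[of _ y]) auto
  next
    case False
    define h where "h k = norm (halpern T x0 k - T (halpern T x0 k) - v)" for k
    have "h \<longlonglongrightarrow> 0"
      using halpern_residual_tendsto[OF v, of x0] unfolding h_def
      by (simp add: LIM_zero_iff tendsto_norm_zero_iff)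
    then have "eventually (\<lambda>k. h k < sqrt e) sequentially"
      using e by (intro order_tendstoD) auto
    then obtain K where K: "\<And>k. k \<ge> K \<Longrightarrow> h k < sqrt e"
      using eventually_sequentially by auto
    \<comment> \<open>The sum serves as an upper bound for each of its terms.\<close>
    define R where "R = (\<Sum>k<K. (real k + 1) * h k)"
    have hn: "0 \<le> h k" for k by (simp add: h_def)
    obtain z where z: "norm (z - T z) \<le> norm (y - T y)" and far: "R \<le> norm (x0 - z)"
      using exists_far_point[OF False] by blast
    have "(h k)\<^sup>2 \<le> ((sqrt ((\<Sum>n=1..k. 1 / real n) + 4) + 1) / (real k + 1))\<^sup>2
        * (norm (x0 - z))\<^sup>2 + e" if k: "k \<ge> 1" for k
    proof (cases "k < K")
      case True
      have "(real k + 1) * h k \<le> R"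
        unfolding R_def using True hn by (intro member_le_sum) auto
      then have "((real k + 1) * h k)\<^sup>2 \<le> (norm (x0 - z))\<^sup>2"
        using far hn[of k] by (intro power_mono) auto
      then have "(real k + 1)\<^sup>2 * (h k)\<^sup>2 \<le> (norm (x0 - z))\<^sup>2"
        by (simp only: power_mult_distrib)
      then have "(h k)\<^sup>2 \<le> 1 / (real k + 1)\<^sup>2 * (norm (x0 - z))\<^sup>2"
        by (simp add: pos_le_divide_eq mult.commute)
      also have "\<dots> \<le> 10 / (real k + 1)\<^sup>2 * (norm (x0 - z))\<^sup>2"
        by (intro mult_right_mono divide_right_mono) auto
      also have "\<dots> \<le> ((sqrt ((\<Sum>n=1..k. 1 / real n) + 4) + 1) / (real k + 1))\<^sup>2
          * (norm (x0 - z))\<^sup>2"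
        by (intro mult_right_mono log_rate_ge(2) k) auto
      finally show ?thesis using e by linarith
    next
      case False
      then have "(h k)\<^sup>2 \<le> (sqrt e)\<^sup>2"
        using K[of k] hn[of k] by (intro power_mono) auto
      then have "(h k)\<^sup>2 \<le> e" using e by simp
      then show ?thesis by (simp add: add_increasing)
    qed
    moreover have "(norm (z - T z))\<^sup>2 - (norm v)\<^sup>2 < e"
      using y e power_mono[OF z norm_ge_zero, of 2] by linarith
    ultimately show ?thesis
      unfolding h_def by blast
  qed
qed

end

theorem corollary9:
  fixes T :: "'a::{real_inner, complete_space} \<Rightarrow> 'a"
    and v :: 'a
    and x :: "nat \<Rightarrow> 'a"
  assumes "nonexpansive T"
    and "v = infimal_displacement T"
    and "\<And>k. x (Suc k) = (1 / (real k + 2)) *\<^sub>R x 0 + ((real k + 1) / (real k + 2)) *\<^sub>R T (x k)"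
  shows "(\<forall>\<epsilon>::real. \<epsilon> > 0 \<longrightarrow>
           (\<exists>xe. norm (xe - T xe - v) < \<epsilon> \<and>
             (\<forall>k\<ge>1.
               (norm ((2 / real k) *\<^sub>R (x k - x 0) + v))\<^sup>2 \<le> (4 / real k * norm (x 0 - xe) + \<epsilon>)\<^sup>2 \<and>
               (norm (x k - T (x k)) - norm v)\<^sup>2 \<le> (4 / real k * norm (x 0 - xe) + \<epsilon>)\<^sup>2 \<and>
               (norm (x k - T (x k) - v))\<^sup>2 \<le>
                 ((sqrt ((\<Sum>n=1..k. 1 / real n) + 4) + 1) / (real k + 1))\<^sup>2 * (norm (x 0 - xe))\<^sup>2 + \<epsilon>)))
       \<and> (v \<in> displacement_range T \<longrightarrow>
           (\<exists>xs. xs - T xs = v \<and>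
             (\<forall>k\<ge>1.
               (norm ((2 / real k) *\<^sub>R (x k - x 0) + v))\<^sup>2 \<le> 16 / (real k)\<^sup>2 * (norm (x 0 - xs))\<^sup>2 \<and>
               (norm (x k - T (x k)) - norm v)\<^sup>2 \<le> 16 / (real k)\<^sup>2 * (norm (x 0 - xs))\<^sup>2 \<and>
               (norm (x k - T (x k) - v))\<^sup>2 \<le>
                 ((sqrt ((\<Sum>n=1..k. 1 / real n) + 4) + 1) / (real k + 1))\<^sup>2 * (norm (x 0 - xs))\<^sup>2)))"
proof -
  have T: "nonexpansive T" by fact
  note v_def = \<open>v = infimal_displacement T\<close>
  have v: "v \<in> closure (displacement_range T)"
    unfolding v_def by (rule infimal_displacement_variational(1)[OF T])
  interpret variational_displacement T v
    using T infimal_displacement_variational(2)[OF T] by unfold_locales (auto simp: v_def)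
  have x: "x k = halpern T (x 0) k" for k
  proof (induction k)
    case (Suc k)
    then show ?case using assms(3)[of k] by simp
  qed simp
  have sq: "a\<^sup>2 \<le> (b + c)\<^sup>2" if "\<bar>a\<bar> \<le> b + s" "s \<le> c" for a b c s :: real
    using that by (intro power2_le_iff_abs_le[THEN iffD2]) auto
  show ?thesis
  proof (intro conjI allI impI)
    fix \<epsilon> :: real assume e: "\<epsilon> > 0"
    \<comment> \<open>\<open>\<epsilon>\<close> is the tolerance of the third bound, and \<open>\<epsilon>\<^sup>2\<close> that of the squared norm behind the others.\<close>
    define \<delta> where "\<delta> = min \<epsilon> (\<epsilon>\<^sup>2)"
    have \<delta>: "\<delta> > 0" "\<delta> \<le> \<epsilon>" "\<delta> \<le> \<epsilon>\<^sup>2" using e by (auto simp: \<delta>_def)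
    obtain z where z: "(norm (z - T z))\<^sup>2 - (norm v)\<^sup>2 < \<delta>"
      and rate: "\<And>k. k \<ge> 1 \<Longrightarrow> (norm (x k - T (x k) - v))\<^sup>2
        \<le> ((sqrt ((\<Sum>n=1..k. 1 / real n) + 4) + 1) / (real k + 1))\<^sup>2 * (norm (x 0 - z))\<^sup>2 + \<delta>"
      using approximate_reference_point[OF v \<delta>(1), of "x 0"] unfolding x[symmetric] by blast
    define s where "s = sqrt ((norm (z - T z))\<^sup>2 - (norm v)\<^sup>2)"
    have "s < sqrt (\<epsilon>\<^sup>2)" unfolding s_def using z \<delta>(3) by (intro real_sqrt_less_mono) linarith
    then have s: "s < \<epsilon>" using e by simp
    have "norm (z - T z - v) \<le> s"
      unfolding s_def by (rule real_le_rsqrt[OF norm_displacement_minus_v])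
    then have near: "norm (z - T z - v) < \<epsilon>" using s by linarith
    show "\<exists>xe. norm (xe - T xe - v) < \<epsilon> \<and>
      (\<forall>k\<ge>1.
        (norm ((2 / real k) *\<^sub>R (x k - x 0) + v))\<^sup>2 \<le> (4 / real k * norm (x 0 - xe) + \<epsilon>)\<^sup>2 \<and>
        (norm (x k - T (x k)) - norm v)\<^sup>2 \<le> (4 / real k * norm (x 0 - xe) + \<epsilon>)\<^sup>2 \<and>
        (norm (x k - T (x k) - v))\<^sup>2 \<le>
          ((sqrt ((\<Sum>n=1..k. 1 / real n) + 4) + 1) / (real k + 1))\<^sup>2 * (norm (x 0 - xe))\<^sup>2 + \<epsilon>)"
    proof (intro exI[of _ z] conjI allI impI near)
      fix k :: nat assume k: "k \<ge> 1"
      show "(norm ((2 / real k) *\<^sub>R (x k - x 0) + v))\<^sup>2 \<le> (4 / real k * norm (x 0 - z) + \<epsilon>)\<^sup>2"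
        using halpern_normalized_iterate[OF k, of "x 0" z] s
        unfolding x[symmetric] s_def[symmetric] by (intro sq[of _ _ s]) auto
      show "(norm (x k - T (x k)) - norm v)\<^sup>2 \<le> (4 / real k * norm (x 0 - z) + \<epsilon>)\<^sup>2"
        using halpern_residual_norm_gap[OF k, of "x 0" z] s
        unfolding x[symmetric] s_def[symmetric] by (intro sq[of _ _ s]) auto
      show "(norm (x k - T (x k) - v))\<^sup>2
        \<le> ((sqrt ((\<Sum>n=1..k. 1 / real n) + 4) + 1) / (real k + 1))\<^sup>2 * (norm (x 0 - z))\<^sup>2 + \<epsilon>"
        using rate[OF k] \<delta>(2) by linarith
    qed
  next
    assume "v \<in> displacement_range T"
    then obtain z where z: "z - T z = v"
      and rate: "\<And>k. k \<ge> 1 \<Longrightarrow> (norm (x k - T (x k) - v))\<^sup>2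
        \<le> ((sqrt ((\<Sum>n=1..k. 1 / real n) + 4) + 1) / (real k + 1))\<^sup>2 * (norm (x 0 - z))\<^sup>2"
      using exact_reference_point[of "x 0"] unfolding x[symmetric] by blast
    show "\<exists>xs. xs - T xs = v \<and>
      (\<forall>k\<ge>1.
        (norm ((2 / real k) *\<^sub>R (x k - x 0) + v))\<^sup>2 \<le> 16 / (real k)\<^sup>2 * (norm (x 0 - xs))\<^sup>2 \<and>
        (norm (x k - T (x k)) - norm v)\<^sup>2 \<le> 16 / (real k)\<^sup>2 * (norm (x 0 - xs))\<^sup>2 \<and>
        (norm (x k - T (x k) - v))\<^sup>2 \<le>
          ((sqrt ((\<Sum>n=1..k. 1 / real n) + 4) + 1) / (real k + 1))\<^sup>2 * (norm (x 0 - xs))\<^sup>2)"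
    proof (intro exI[of _ z] conjI allI impI z)
      fix k :: nat assume k: "k \<ge> 1"
      have sq16: "16 / (real k)\<^sup>2 * (norm (x 0 - z))\<^sup>2 = (4 / real k * norm (x 0 - z) + 0)\<^sup>2"
        by (simp add: power_mult_distrib power_divide)
      show "(norm ((2 / real k) *\<^sub>R (x k - x 0) + v))\<^sup>2 \<le> 16 / (real k)\<^sup>2 * (norm (x 0 - z))\<^sup>2"
        unfolding sq16 using halpern_normalized_iterate[OF k, of "x 0" z]
        unfolding x[symmetric] by (intro sq[of _ _ 0]) (auto simp: z)
      show "(norm (x k - T (x k)) - norm v)\<^sup>2 \<le> 16 / (real k)\<^sup>2 * (norm (x 0 - z))\<^sup>2"
        unfolding sq16 using halpern_residual_norm_gap[OF k, of "x 0" z]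
        unfolding x[symmetric] by (intro sq[of _ _ 0]) (auto simp: z)
      show "(norm (x k - T (x k) - v))\<^sup>2
        \<le> ((sqrt ((\<Sum>n=1..k. 1 / real n) + 4) + 1) / (real k + 1))\<^sup>2 * (norm (x 0 - z))\<^sup>2"
        by (rule rate[OF k])
    qed
  qed
qed

end
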